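(* Suppose $E$ is an arbitrary directed graph. Then the path category $E^*$ (regarded as a $1$-graph) is cofinal if and only if for every $v,w\in E^0$ there exists $n\in\mathbb{N}$ such that $vE^*s(\alpha)\neq\emptyset$ for each $\alpha\in wX_n$.
   Context: A directed graph is a quadruple $E=(E^0,E^1,r,s)$ with $E^0,E^1$ countable sets (vertices and edges) and maps $r,s:E^1\to E^0$ (range and source). $E^*$ is the set of finite paths: vertices (length $0$) together with sequences $\lambda=\lambda_1\cdots\lambda_l$ of edges with $s(\lambda_i)=r(\lambda_{i+1})$, with $r(\lambda)=r(\lambda_1)$, $s(\lambda)=s(\lambda_l)$; $d(\lambda)=|\lambda|=l\in\mathbb{N}$ is the length. Under concatenation ($\mu\nu$ is defined when $s(\mu)=r(\nu)$) $E^*$ is a category, and with $d$ it is a $1$-graph. For $m\le d(\lambda)$, $\lambda(m)$ denotes the vertex reached after the first $m$ edges, i.e. $\lambda(m)=s(\lambda')$ where $\lambda=\lambda'\lambda''$ with $d(\lambda')=m$ (so $\lambda(0)=r(\lambda)$). For $u\in E^0$: $uE^1=\{e\in E^1:r(e)=u\}$, $uX=\{\lambda\in X:r(\lambda)=u\}$ for $X\subseteq E^*$, and $vE^*w=\{\lambda\in E^*:r(\lambda)=v,\ s(\lambda)=w\}$. For $n\in\mathbb{N}$ (with $0\in\mathbb N$), $$X_n=\{\lambda\in E^*: d(\lambda)\le n,\ |\lambda(m)E^1|<\infty\text{ for every } m<d(\lambda),\text{ and if } d(\lambda)<n\text{ then } |s(\lambda)E^1|\in\{0,\infty\}\}.$$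 For paths $\mu,\nu\in E^*$, $\operatorname{MCE}(\mu,\nu)$ is the set of paths $\lambda$ of length $\max(d(\mu),d(\nu))$ having both $\mu$ and $\nu$ as initial segments. A set $F\subseteq wE^*$ is exhaustive if for every $\mu\in wE^*$ there is $\lambda\in F$ with $\operatorname{MCE}(\mu,\lambda)\neq\emptyset$. $E^*$ is cofinal if for all $v,w\in E^0$ there is a finite exhaustive set $F\subseteq wE^*$ such that $vE^*s(\alpha)\neq\emptyset$ for every $\alpha\in F$. *)

theory Defs
  imports "Graph_Theory.Digraph" "HOL-Library.Countable_Set"
begin

text \<open>
  A directed graph \<open>(E\<^sup>0, E\<^sup>1, r, s)\<close> is a \<open>pre_digraph\<close> with \<open>E\<^sup>0 = verts E\<close>,
  \<open>E\<^sup>1 = arcs E\<close>, range map \<open>r = head E\<close> and source map \<open>s = tail E\<close>.  Loops, parallel edges and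
  infinite graphs are allowed.  The set \<open>u E\<^sup>1\<close> of edges with range \<open>u\<close> is \<open>in_arcs E u\<close>.
\<close>

locale directed_graph = wf_digraph E for E :: "('v, 'e) pre_digraph" +
  assumes countable_verts: "countable (verts E)"
    and countable_arcs: "countable (arcs E)"

text \<open>
  A finite path is represented by its range together with its list of edges, so that a vertex \<open>v\<close>,
  as a path of length 0, is \<open>(v, [])\<close>.  Paths are read in the order of composition of a category:
  consecutive edges satisfy \<open>s(\<alpha>\<^sub>i) = r(\<alpha>\<^sub>i\<^sub>+\<^sub>1)\<close>.  They are thus traversed against the
  direction of the arcs, opposite to \<open>awalk\<close>.
\<close>

type_synonym ('v, 'e) fpath = "'v \<times> 'e list"

definition path_rng :: "('v, 'e) fpath \<Rightarrow> 'v" where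
  "path_rng \<alpha> = fst \<alpha>"

definition path_src :: "('v, 'e) pre_digraph \<Rightarrow> ('v, 'e) fpath \<Rightarrow> 'v" where
  "path_src E \<alpha> = (if snd \<alpha> = [] then fst \<alpha> else tail E (last (snd \<alpha>)))"

definition path_len :: "('v, 'e) fpath \<Rightarrow> nat" where
  "path_len \<alpha> = length (snd \<alpha>)"

definition paths :: "('v, 'e) pre_digraph \<Rightarrow> ('v, 'e) fpath set" where
  "paths E = {(v, es). v \<in> verts E \<and> set es \<subseteq> arcs E
     \<and> (es \<noteq> [] \<longrightarrow> v = head E (hd es))
     \<and> (\<forall>i. Suc i < length es \<longrightarrow> tail E (es ! i) = head E (es ! Suc i))}"

definition hom_paths :: "('v, 'e) pre_digraph \<Rightarrow> 'v \<Rightarrow> 'v \<Rightarrow> ('v, 'e) fpath set" where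
  "hom_paths E v w = {\<alpha> \<in> paths E. path_rng \<alpha> = v \<and> path_src E \<alpha> = w}"

definition with_rng :: "'v \<Rightarrow> ('v, 'e) fpath set \<Rightarrow> ('v, 'e) fpath set" where
  "with_rng u X = {\<alpha> \<in> X. path_rng \<alpha> = u}"

text \<open>The concatenation \<open>\<mu>\<nu>\<close> is only meaningful when \<open>s(\<mu>) = r(\<nu>)\<close>.\<close>

definition path_comp :: "('v, 'e) fpath \<Rightarrow> ('v, 'e) fpath \<Rightarrow> ('v, 'e) fpath" where
  "path_comp \<mu> \<nu> = (fst \<mu>, snd \<mu> @ snd \<nu>)"

definition initial_segment ::
    "('v, 'e) pre_digraph \<Rightarrow> ('v, 'e) fpath \<Rightarrow> ('v, 'e) fpath \<Rightarrow> bool" where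
  "initial_segment E \<mu> \<alpha> \<longleftrightarrow>
     \<mu> \<in> paths E \<and> (\<exists>\<nu> \<in> paths E. path_src E \<mu> = path_rng \<nu> \<and> \<alpha> = path_comp \<mu> \<nu>)"

text \<open>The vertex \<open>\<alpha>(m)\<close>, for \<open>m \<le> d(\<alpha>)\<close>: the source of the initial segment of length \<open>m\<close>.\<close>

definition path_vertex :: "('v, 'e) pre_digraph \<Rightarrow> ('v, 'e) fpath \<Rightarrow> nat \<Rightarrow> 'v" where
  "path_vertex E \<alpha> m = path_src E (fst \<alpha>, take m (snd \<alpha>))"

definition X_paths :: "('v, 'e) pre_digraph \<Rightarrow> nat \<Rightarrow> ('v, 'e) fpath set" where
  "X_paths E n = {\<alpha> \<in> paths E. path_len \<alpha> \<le> n
     \<and> (\<forall>m < path_len \<alpha>. finite (in_arcs E (path_vertex E \<alpha> m)))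
     \<and> (path_len \<alpha> < n \<longrightarrow>
          in_arcs E (path_src E \<alpha>) = {} \<or> infinite (in_arcs E (path_src E \<alpha>)))}"

definition MCE ::
    "('v, 'e) pre_digraph \<Rightarrow> ('v, 'e) fpath \<Rightarrow> ('v, 'e) fpath \<Rightarrow> ('v, 'e) fpath set" where
  "MCE E \<mu> \<nu> = {\<alpha> \<in> paths E. path_len \<alpha> = max (path_len \<mu>) (path_len \<nu>)
     \<and> initial_segment E \<mu> \<alpha> \<and> initial_segment E \<nu> \<alpha>}"

definition exhaustive :: "('v, 'e) pre_digraph \<Rightarrow> 'v \<Rightarrow> ('v, 'e) fpath set \<Rightarrow> bool" where
  "exhaustive E w F \<longleftrightarrow> F \<subseteq> with_rng w (paths E)
     \<and> (\<forall>\<mu> \<in> with_rng w (paths E). \<exists>\<alpha> \<in> F. MCE E \<mu> \<alpha> \<noteq> {})"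

definition path_cofinal :: "('v, 'e) pre_digraph \<Rightarrow> bool" where
  "path_cofinal E \<longleftrightarrow> (\<forall>v \<in> verts E. \<forall>w \<in> verts E.
     \<exists>F. finite F \<and> exhaustive E w F \<and> (\<forall>\<alpha> \<in> F. hom_paths E v (path_src E \<alpha>) \<noteq> {}))"

end

theory Submission
  imports Defs "HOL-Library.Sublist"
begin

text \<open>
  A nonempty \<open>MCE\<close> of two paths with the same range means that one of them extends the other.
  By induction on \<open>n\<close>, \<open>w X\<^sub>n\<close> is finite and exhaustive, which gives one direction.  Conversely, let
  \<open>F \<subseteq> w E\<^sup>*\<close> be finite and exhaustive, let \<open>n\<close> bound the lengths of its elements, and let \<open>\<mu> \<in> w X\<^sub>n\<close>.
  If some \<open>\<alpha> \<in> F\<close> is an initial segment of \<open>\<mu>\<close>, then \<open>v E\<^sup>* s(\<mu>) \<noteq> \<emptyset>\<close> by concatenation.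
  Otherwise \<open>\<mu>\<close> is properly extended by an element of \<open>F\<close>, so \<open>d(\<mu>) < n\<close> and \<open>s(\<mu>)\<close> receives
  infinitely many edges; choosing such an edge \<open>e\<close> that no element of \<open>F\<close> uses makes \<open>\<mu>e\<close>
  incomparable with everything in \<open>F\<close>.
\<close>

lemma path_src_Nil [simp]: "path_src E (v, []) = v"
  by (simp add: path_src_def)

lemma path_src_Cons [simp]: "path_src E (v, e # es) = path_src E (tail E e, es)"
  by (simp add: path_src_def)

lemma path_src_append: "path_src E (v, es @ fs) = path_src E (path_src E (v, es), fs)"
  by (induction es arbitrary: v) simp_all

context wf_digraph
begin

lemma Nil_in_paths_iff [simp]: "(v, []) \<in> paths G \<longleftrightarrow> v \<in> verts G"
  by (simp add: paths_def)

text \<open>Turns the index-based definition of \<open>paths\<close> into a recursion on the first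
  edge, the form that inductions on edge lists need.\<close>

lemma Cons_in_paths_iff [simp]:
  "(v, e # es) \<in> paths G \<longleftrightarrow> e \<in> in_arcs G v \<and> (tail G e, es) \<in> paths G"
proof (cases es)
  case Nil
  then show ?thesis by (auto simp: paths_def)
next
  case (Cons f fs)
  have "(\<forall>i. Suc i < length (e # es) \<longrightarrow> tail G ((e # es) ! i) = head G ((e # es) ! Suc i)) \<longleftrightarrow>
      tail G e = head G f \<and> (\<forall>i. Suc i < length es \<longrightarrow> tail G (es ! i) = head G (es ! Suc i))"
    by (simp add: Cons All_less_Suc2)
  then show ?thesis
    by (auto simp: paths_def Cons)
qed

lemma append_in_paths_iff:
  "(v, es @ fs) \<in> paths G \<longleftrightarrow> (v, es) \<in> paths G \<and> (path_src G (v, es), fs) \<in> paths G"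
proof (induction es arbitrary: v)
  case Nil
  then show ?case by (auto simp: paths_def)
qed auto

lemma initial_segment_iff_prefix:
  assumes "(v, fs) \<in> paths G"
  shows "initial_segment G (v, es) (v, fs) \<longleftrightarrow> prefix es fs"
  using assms
  by (auto simp: initial_segment_def path_comp_def path_rng_def prefix_def append_in_paths_iff
      intro!: bexI[where x = "(path_src G (v, es), _)"])

lemma MCE_nonempty_iff:
  assumes "(v, es) \<in> paths G" "(v, fs) \<in> paths G"
  shows "MCE G (v, es) (v, fs) \<noteq> {} \<longleftrightarrow> prefix es fs \<or> prefix fs es"
proof
  assume "MCE G (v, es) (v, fs) \<noteq> {}"
  then obtain u gs where "(u, gs) \<in> paths G"
    "initial_segment G (v, es) (u, gs)" "initial_segment G (v, fs) (u, gs)"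
    unfolding MCE_def by auto
  then have "prefix es gs" "prefix fs gs"
    by (auto simp: initial_segment_def path_comp_def intro: prefixI)
  then show "prefix es fs \<or> prefix fs es"
    using prefix_same_cases by blast
next
  assume "prefix es fs \<or> prefix fs es"
  then have "(v, fs) \<in> MCE G (v, es) (v, fs) \<or> (v, es) \<in> MCE G (v, es) (v, fs)"
    using assms by (auto simp: MCE_def path_len_def initial_segment_iff_prefix max_def
        dest: prefix_length_le)
  then show "MCE G (v, es) (v, fs) \<noteq> {}"
    by blast
qed

text \<open>All paths involved share the range \<open>w\<close>, so only their edge lists matter and
  \<open>MCE\<close> reduces to the prefix order.\<close>

lemma exhaustive_iff_comparable:
  "exhaustive G w F \<longleftrightarrow> F \<subseteq> with_rng w (paths G) \<and>
    (\<forall>es. (w, es) \<in> paths G \<longrightarrow> (\<exists>fs. (w, fs) \<in> F \<and> (prefix es fs \<or> prefix fs es)))"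
proof (cases "F \<subseteq> with_rng w (paths G)")
  case True
  have rng: "\<alpha> \<in> with_rng w (paths G) \<longleftrightarrow> (\<exists>es. \<alpha> = (w, es) \<and> (w, es) \<in> paths G)" for \<alpha>
    by (cases \<alpha>) (auto simp: with_rng_def path_rng_def)
  have "(\<exists>\<alpha>\<in>F. MCE G (w, es) \<alpha> \<noteq> {}) \<longleftrightarrow>
      (\<exists>fs. (w, fs) \<in> F \<and> (prefix es fs \<or> prefix fs es))"
    if "(w, es) \<in> paths G" for es
    using True that MCE_nonempty_iff rng by (smt (verit, best) subsetD)
  then show ?thesis
    using True by (auto simp: exhaustive_def rng)
qed (simp add: exhaustive_def)

text \<open>The edges \<open>fs\<close> also continue any path from \<open>v\<close> that has the
  same source as \<open>(w, es)\<close>.\<close>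

lemma hom_paths_nonempty_append:
  assumes "hom_paths G v (path_src G (w, es)) \<noteq> {}" "(w, es @ fs) \<in> paths G"
  shows "hom_paths G v (path_src G (w, es @ fs)) \<noteq> {}"
proof -
  obtain gs where "(v, gs) \<in> paths G" "path_src G (v, gs) = path_src G (w, es)"
    using assms(1) by (auto simp: hom_paths_def path_rng_def)
  then have "(v, gs @ fs) \<in> hom_paths G v (path_src G (w, es @ fs))"
    using assms(2) by (auto simp: hom_paths_def path_rng_def append_in_paths_iff path_src_append)
  then show ?thesis by blast
qed

lemma Nil_in_X_paths_iff:
  "(w, []) \<in> X_paths G n \<longleftrightarrow>
    w \<in> verts G \<and> (n = 0 \<or> in_arcs G w = {} \<or> infinite (in_arcs G w))"
  by (auto simp: X_paths_def path_len_def)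

text \<open>Dropping the first edge lowers both the length and the bound by one, so the condition at
  the source is unchanged; only finiteness at \<open>w\<close>, the vertex of index 0, splits
  off.\<close>

lemma Cons_in_X_paths_iff:
  "(w, e # es) \<in> X_paths G n \<longleftrightarrow>
    (\<exists>m. n = Suc m \<and> e \<in> in_arcs G w \<and> finite (in_arcs G w) \<and> (tail G e, es) \<in> X_paths G m)"
proof (cases n)
  case (Suc m)
  have "(\<forall>i < Suc (length es). finite (in_arcs G (path_vertex G (w, e # es) i))) \<longleftrightarrow>
      finite (in_arcs G w) \<and>
      (\<forall>i < length es. finite (in_arcs G (path_vertex G (tail G e, es) i)))"
    by (subst All_less_Suc2) (simp add: path_vertex_def)
  then show ?thesis
    by (auto simp: X_paths_def path_len_def Suc)
qed (simp add: X_paths_def path_len_def)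

lemma finite_with_rng_X_paths: "finite (with_rng w (X_paths G n))"
proof (induction n arbitrary: w)
  case 0
  have "with_rng w (X_paths G 0) \<subseteq> {(w, [])}"
    by (auto simp: with_rng_def path_rng_def X_paths_def path_len_def)
  then show ?case by (rule finite_subset) simp
next
  case (Suc n)
  \<comment> \<open>If \<open>w\<close> receives infinitely many edges, no element of
    \<open>X_paths\<close> continues past \<open>w\<close>, so the union may be taken over the empty
    set and stays finite.\<close>
  define A where "A = (if finite (in_arcs G w) then in_arcs G w else {})"
  have "with_rng w (X_paths G (Suc n)) \<subseteq>
      insert (w, []) (\<Union>e\<in>A. (\<lambda>\<alpha>. (w, e # snd \<alpha>)) ` with_rng (tail G e) (X_paths G n))"
  proof
    fix \<alpha> assume "\<alpha> \<in> with_rng w (X_paths G (Suc n))"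
    then obtain es where \<alpha>: "\<alpha> = (w, es)" "(w, es) \<in> X_paths G (Suc n)"
      by (cases \<alpha>) (auto simp: with_rng_def path_rng_def)
    show "\<alpha> \<in> insert (w, [])
        (\<Union>e\<in>A. (\<lambda>\<alpha>. (w, e # snd \<alpha>)) ` with_rng (tail G e) (X_paths G n))"
    proof (cases es)
      case (Cons e fs)
      with \<alpha> have "e \<in> A" "(tail G e, fs) \<in> with_rng (tail G e) (X_paths G n)"
        by (auto simp: Cons_in_X_paths_iff A_def with_rng_def path_rng_def)
      then show ?thesis using \<alpha> Cons by force
    qed (simp add: \<alpha>)
  qed
  then show ?case
    by (rule finite_subset) (auto simp: A_def Suc.IH)
qed

text \<open>Follow \<open>es\<close> until \<open>n\<close> edges are used or a vertex receiving no
  or infinitely many edges is reached; if \<open>es\<close> ends earlier, continue along arbitrary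
  edges.\<close>

lemma ex_comparable_X_path:
  assumes "(w, es) \<in> paths G"
  shows "\<exists>fs. (w, fs) \<in> X_paths G n \<and> (prefix es fs \<or> prefix fs es)"
  using assms
proof (induction n arbitrary: w es)
  case 0
  then have "(w, []) \<in> X_paths G 0"
    by (auto simp: Nil_in_X_paths_iff paths_def)
  then show ?case by auto
next
  case (Suc n)
  show ?case
  proof (cases "in_arcs G w = {} \<or> infinite (in_arcs G w)")
    case True
    then have "(w, []) \<in> X_paths G (Suc n)"
      using Suc.prems by (auto simp: Nil_in_X_paths_iff paths_def)
    then show ?thesis by auto
  next
    case False
    have step: "\<exists>gs. (w, e # gs) \<in> X_paths G (Suc n) \<and> (prefix fs gs \<or> prefix gs fs)"
      if "(w, e # fs) \<in> paths G" for e fs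
      using Suc.IH[of "tail G e" fs] that False by (auto simp: Cons_in_X_paths_iff)
    show ?thesis
    proof (cases es)
      case Nil
      \<comment> \<open>Here \<open>es\<close> is used up, but \<open>w\<close> receives a finite
        nonzero number of edges, so stopping is not allowed; any edge serves.\<close>
      from False obtain e where "e \<in> in_arcs G w" by blast
      then have "(w, e # []) \<in> paths G" by simp
      from step[OF this] show ?thesis using Nil by auto
    next
      case (Cons e fs)
      then show ?thesis using step[of e fs] Suc.prems by fastforce
    qed
  qed
qed

lemma exhaustive_X_paths: "exhaustive G w (with_rng w (X_paths G n))"
  using ex_comparable_X_path
  by (fastforce simp: exhaustive_iff_comparable with_rng_def path_rng_def X_paths_def)

lemma exhaustive_prefix_of_X_path:
  assumes "finite F" "exhaustive G w F"
    and len: "\<And>\<alpha>. \<alpha> \<in> F \<Longrightarrow> path_len \<alpha> \<le> n"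
    and X: "(w, es) \<in> X_paths G n"
  shows "\<exists>fs. (w, fs) \<in> F \<and> prefix fs es"
proof (rule ccontr)
  assume contra: "\<not> ?thesis"
  have comparable: "\<exists>fs. (w, fs) \<in> F \<and> (prefix gs fs \<or> prefix fs gs)" if "(w, gs) \<in> paths G" for gs
    using assms(2) that by (simp add: exhaustive_iff_comparable)
  have path: "(w, es) \<in> paths G"
    using X by (simp add: X_paths_def)
  with comparable contra obtain fs where fs: "(w, fs) \<in> F" "prefix es fs" by blast
  with contra obtain e gs where fs_eq: "fs = es @ e # gs"
    by (metis append_Nil2 neq_Nil_conv prefix_def prefix_order.refl)
  have "(w, fs) \<in> paths G"
    using fs(1) assms(2) by (auto simp: exhaustive_def with_rng_def)
  \<comment> \<open>The edge \<open>e\<close> of \<open>fs\<close> ends at this vertex, which leaves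
    only the infinite alternative in \<open>X_paths\<close>.\<close>
  then have "in_arcs G (path_src G (w, es)) \<noteq> {}"
    by (auto simp: fs_eq append_in_paths_iff simp del: in_in_arcs_conv)
  moreover have "path_len (w, es) < n"
    using len[OF fs(1)] by (simp add: path_len_def fs_eq)
  ultimately have "infinite (in_arcs G (path_src G (w, es)))"
    using X by (simp add: X_paths_def)
  moreover have "finite (\<Union>\<alpha>\<in>F. set (snd \<alpha>))"
    using assms(1) by simp
  ultimately obtain a where a: "a \<in> in_arcs G (path_src G (w, es))" "a \<notin> (\<Union>\<alpha>\<in>F. set (snd \<alpha>))"
    by (meson finite_subset subsetI)
  then have "(w, es @ [a]) \<in> paths G"
    using path by (auto simp: append_in_paths_iff)
  with comparable obtain hs where hs: "(w, hs) \<in> F" "prefix (es @ [a]) hs \<or> prefix hs (es @ [a])"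
    by blast
  have "a \<notin> set hs"
    using a(2) hs(1) by force
  \<comment> \<open>Since \<open>hs\<close> avoids \<open>a\<close>, it neither extends
    \<open>es @ [a]\<close> nor equals it, so it is a prefix that stops within
    \<open>es\<close>.\<close>
  with hs(2) have "prefix hs es"
    by (auto simp: prefix_snoc dest: set_mono_prefix)
  with hs(1) contra show False by blast
qed

end

theorem propositionA4:
  fixes E :: "('v, 'e) pre_digraph"
  assumes "directed_graph E"
  shows "path_cofinal E \<longleftrightarrow>
    (\<forall>v \<in> verts E. \<forall>w \<in> verts E. \<exists>n :: nat.
       \<forall>\<alpha> \<in> with_rng w (X_paths E n). hom_paths E v (path_src E \<alpha>) \<noteq> {})"
proof
  interpret wf_digraph E
    using assms by (rule directed_graph.axioms)
  {
    assume cofinal: "path_cofinal E"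
    show "\<forall>v \<in> verts E. \<forall>w \<in> verts E. \<exists>n.
       \<forall>\<alpha> \<in> with_rng w (X_paths E n). hom_paths E v (path_src E \<alpha>) \<noteq> {}"
    proof (intro ballI)
      fix v w assume "v \<in> verts E" "w \<in> verts E"
      with cofinal obtain F where F: "finite F" "exhaustive E w F"
        "\<And>\<alpha>. \<alpha> \<in> F \<Longrightarrow> hom_paths E v (path_src E \<alpha>) \<noteq> {}"
        unfolding path_cofinal_def by meson
      obtain n where n: "\<And>\<alpha>. \<alpha> \<in> F \<Longrightarrow> path_len \<alpha> \<le> n"
        using F(1) by (metis finite_imageI finite_nat_set_iff_bounded_le imageI)
      have "hom_paths E v (path_src E \<mu>) \<noteq> {}" if "\<mu> \<in> with_rng w (X_paths E n)" for \<mu>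
      proof -
        from that obtain es where \<mu>: "\<mu> = (w, es)" and X: "(w, es) \<in> X_paths E n"
          by (cases \<mu>) (auto simp: with_rng_def path_rng_def)
        obtain fs gs where "(w, fs) \<in> F" "es = fs @ gs"
          using exhaustive_prefix_of_X_path[OF F(1,2) n X] by (auto simp: prefix_def)
        then show ?thesis
          using hom_paths_nonempty_append[OF F(3)] X by (auto simp: \<mu> X_paths_def)
      qed
      then show "\<exists>n. \<forall>\<alpha> \<in> with_rng w (X_paths E n). hom_paths E v (path_src E \<alpha>) \<noteq> {}"
        by blast
    qed
  next
    assume "\<forall>v \<in> verts E. \<forall>w \<in> verts E. \<exists>n.
       \<forall>\<alpha> \<in> with_rng w (X_paths E n). hom_paths E v (path_src E \<alpha>) \<noteq> {}"
    \<comment> \<open>The finite exhaustive set is \<open>with_rng w (X_paths E n)\<close> itself,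
      with \<open>n\<close> from the assumption.\<close>
    then show "path_cofinal E"
      unfolding path_cofinal_def using finite_with_rng_X_paths exhaustive_X_paths by meson
  }
qed

end
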